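(* Let $M=\mathbb R^2$ with coordinate $z=x+iy$ and $\omega=\frac i2dz\wedge d\bar z=dx\wedge dy$, let $\nabla$ be a symplectic connection on $M$ with parameters $\alpha,\beta:\mathbb R^2\to\mathbb C$, and identify its twistor space $\mathcal Z^0$ with $\mathbb R^2\times\mathcal D$, $\mathcal D=\{w\in\mathbb C:|w|<1\}$, with complex structure $\mathcal J^\nabla$. Put $$\mathcal P(z,w)=-\overline{\beta}+3\overline{\alpha}w-3\alpha w^2+\beta w^3,$$ where $\alpha,\beta$ are evaluated at $z$. Then: (i) A (smooth, complex valued, locally defined) function $f=f(z,w)$ on $\mathcal Z^0$ is holomorphic if and only if $$\frac{\partial f}{\partial\bar w}=0\quad\text{and}\quad\frac{\partial f}{\partial\bar z}+w\frac{\partial f}{\partial z}+\mathcal P(z,w)\frac{\partial f}{\partial w}=0.$$ (ii) Let $j:\mathbb R^2\to\mathcal Z^0$ be a section, represented in coordinates by $z\mapsto(z,w(z))$. Then $j$ is $(j,\mathcal J^\nabla)$-holomorphic if and only if $w$ satisfies $$\frac{\partial w}{\partial\bar z}+w\frac{\partial w}{\partial z}-\mathcal P(z,w(z))=0.$$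
   Context: A symplectic connection is a torsion-free (real) linear connection $\nabla$ with $\nabla\omega=0$. On $(\mathbb R^2,\omega)$, extended complex-linearly, it is determined by smooth functions $\alpha,\beta:\mathbb R^2\to\mathbb C$ through $\nabla_{\partial_z}\partial_z=\alpha\partial_z+\beta\partial_{\bar z}=\overline{\nabla_{\partial_{\bar z}}\partial_{\bar z}}$ and $\nabla_{\partial_z}\partial_{\bar z}=\nabla_{\partial_{\bar z}}\partial_z=-\overline\alpha\partial_z-\alpha\partial_{\bar z}$. $\pi:\mathcal Z^0\to M$ is the bundle whose fibre over $x$ consists of all real endomorphisms $j$ of $T_xM$ with $j^2=-\mathrm{Id}$, $\omega(j\cdot,j\cdot)=\omega$ and $\omega(\cdot,j\cdot)$ positive definite. Each such $j$ at $z$ corresponds to the unique $w\in\mathcal D$ such that the $(-i)$-eigenspace (the $(0,1)$-space) of $j$ in $T_zM\otimes\mathbb C$ is spanned by $\partial_{\bar z}+w\partial_z$; this gives $\mathcal Z^0=\mathbb R^2\times\mathcal D$ with coordinates $(z,w)$. With $\Phi$ the tautological section of $\mathrm{End}(\pi^*TM)$, $\Phi_j=j$, the horizontal distribution $\mathcal H^\nabla=\{X\in T\mathcal Z^0:(\pi^*\nabla)_X\Phi=0\}$ is complementary to $\mathcal V=\ker d\pi$. $\mathcal J^\nabla$ preserves $\mathcal H^\nabla\oplus\mathcal V$; at $j$ it is $(d\pi)^{-1}\circ j\circ d\pi$ on $\mathcal H^\nabla_j$ and, on $\mathcal V_j$ (elements regarded as endomorphisms of $T_{\pi(j)}M$ anticommuting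 with $j$), left multiplication by $j$. It is integrable here, since the real dimension of $M$ is 2. A section $j$ is itself an almost complex structure on $\mathbb R^2$; $(j,\mathcal J^\nabla)$-holomorphic means $dj\circ j=\mathcal J^\nabla\circ dj$, holomorphic as a map from $\mathbb R^2$ with the structure $j$ to $(\mathcal Z^0,\mathcal J^\nabla)$. *)

theory Defs
  imports "HOL-Analysis.Analysis"
begin

text \<open>
  The plane \<open>M = \<real>\<^sup>2\<close> is the type \<^typ>\<open>complex\<close>, regarded as a real vector space
  with coordinate \<open>z = x + iy\<close>.  Tangent vectors are elements of \<^typ>\<open>complex\<close> as
  well: \<open>\<partial>\<^sub>x\<close> is \<open>1\<close> and \<open>\<partial>\<^sub>y\<close> is \<open>\<i>\<close>.
\<close>

fun C_k_on :: "nat \<Rightarrow> 'a::real_normed_vector set \<Rightarrow> ('a \<Rightarrow> 'b::real_normed_vector) \<Rightarrow> bool" where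
  "C_k_on 0 S f \<longleftrightarrow> continuous_on S f"
| "C_k_on (Suc k) S f \<longleftrightarrow>
     (\<forall>x\<in>S. f differentiable (at x)) \<and> (\<forall>v. C_k_on k S (\<lambda>x. frechet_derivative f (at x) v))"

text \<open>Meant for open \<open>S\<close> in a finite-dimensional space.\<close>

definition smooth_on :: "'a::real_normed_vector set \<Rightarrow> ('a \<Rightarrow> 'b::real_normed_vector) \<Rightarrow> bool" where
  "smooth_on S f \<longleftrightarrow> (\<forall>k. C_k_on k S f)"

definition omega :: "complex \<Rightarrow> complex \<Rightarrow> real" where
  "omega u v = Re u * Im v - Im u * Re v"


section \<open>Symplectic connections\<close>

definition lie_bracket :: "(complex \<Rightarrow> complex) \<Rightarrow> (complex \<Rightarrow> complex) \<Rightarrow> complex \<Rightarrow> complex" where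
  "lie_bracket X Y z = frechet_derivative Y (at z) (X z) - frechet_derivative X (at z) (Y z)"

text \<open>
  A connection is an operator \<open>nabla X Y\<close> on smooth vector fields.
  Its values on other arguments are irrelevant.
\<close>

locale linear_connection =
  fixes nabla :: "(complex \<Rightarrow> complex) \<Rightarrow> (complex \<Rightarrow> complex) \<Rightarrow> complex \<Rightarrow> complex"
  assumes smooth:
      "\<lbrakk>smooth_on UNIV X; smooth_on UNIV Y\<rbrakk> \<Longrightarrow> smooth_on UNIV (nabla X Y)"
    and add_left:
      "\<lbrakk>smooth_on UNIV X; smooth_on UNIV X'; smooth_on UNIV Y\<rbrakk>
        \<Longrightarrow> nabla (\<lambda>z. X z + X' z) Y = (\<lambda>z. nabla X Y z + nabla X' Y z)"
    and scale_left:
      "\<lbrakk>smooth_on UNIV (f :: complex \<Rightarrow> real); smooth_on UNIV X; smooth_on UNIV Y\<rbrakk>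
        \<Longrightarrow> nabla (\<lambda>z. f z *\<^sub>R X z) Y = (\<lambda>z. f z *\<^sub>R nabla X Y z)"
    and add_right:
      "\<lbrakk>smooth_on UNIV X; smooth_on UNIV Y; smooth_on UNIV Y'\<rbrakk>
        \<Longrightarrow> nabla X (\<lambda>z. Y z + Y' z) = (\<lambda>z. nabla X Y z + nabla X Y' z)"
    and leibniz:
      "\<lbrakk>smooth_on UNIV (f :: complex \<Rightarrow> real); smooth_on UNIV X; smooth_on UNIV Y\<rbrakk>
        \<Longrightarrow> nabla X (\<lambda>z. f z *\<^sub>R Y z) =
              (\<lambda>z. frechet_derivative f (at z) (X z) *\<^sub>R Y z + f z *\<^sub>R nabla X Y z)"

locale symplectic_connection = linear_connection +
  assumes torsion_free:
      "\<lbrakk>smooth_on UNIV X; smooth_on UNIV Y\<rbrakk>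
        \<Longrightarrow> nabla X Y z - nabla Y X z = lie_bracket X Y z"
    and parallel_omega:
      "\<lbrakk>smooth_on UNIV X; smooth_on UNIV Y; smooth_on UNIV Z\<rbrakk>
        \<Longrightarrow> frechet_derivative (\<lambda>z. omega (Y z) (Z z)) (at z) (X z) =
              omega (nabla X Y z) (Z z) + omega (Y z) (nabla X Z z)"


subsection \<open>Complexified tangent vectors\<close>

text \<open>
  The pair \<open>(u, v)\<close> stands for the element \<open>u + i v\<close> of the complexified tangent space,
  with \<open>u\<close>, \<open>v\<close> real tangent vectors.  This formal \<open>i\<close> is not multiplication by \<open>\<i>\<close>
  in \<^typ>\<open>complex\<close>, which is an endomorphism of the real tangent space.
\<close>

type_synonym ctangent = "complex \<times> complex"

definition cscale :: "complex \<Rightarrow> ctangent \<Rightarrow> ctangent" where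
  "cscale c A = (Re c *\<^sub>R fst A - Im c *\<^sub>R snd A, Re c *\<^sub>R snd A + Im c *\<^sub>R fst A)"

text \<open>\<open>\<partial>\<^sub>z = (\<partial>\<^sub>x - i \<partial>\<^sub>y) / 2\<close> and its conjugate.\<close>

definition del_z :: ctangent where
  "del_z = (1 / 2, - (\<i> / 2))"

definition del_zbar :: ctangent where
  "del_zbar = (1 / 2, \<i> / 2)"

definition complexify_endo :: "(complex \<Rightarrow> complex) \<Rightarrow> ctangent \<Rightarrow> ctangent" where
  "complexify_endo j A = (j (fst A), j (snd A))"

definition complexify_connection ::
    "((complex \<Rightarrow> complex) \<Rightarrow> (complex \<Rightarrow> complex) \<Rightarrow> complex \<Rightarrow> complex)
      \<Rightarrow> (complex \<Rightarrow> ctangent) \<Rightarrow> (complex \<Rightarrow> ctangent) \<Rightarrow> complex \<Rightarrow> ctangent" where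
  "complexify_connection nabla A B z =
     (nabla (fst \<circ> A) (fst \<circ> B) z - nabla (snd \<circ> A) (snd \<circ> B) z,
      nabla (fst \<circ> A) (snd \<circ> B) z + nabla (snd \<circ> A) (fst \<circ> B) z)"

text \<open>
  For a symplectic connection the functions \<open>\<alpha>\<close>, \<open>\<beta>\<close> below determine all remaining
  components, by reality, torsion-freeness and \<open>\<nabla>\<omega> = 0\<close>:
  \<open>\<nabla>\<^bsub>\<partial>z\<^esub> \<partial>\<^sub>z\<^sub>b\<^sub>a\<^sub>r = \<nabla>\<^bsub>\<partial>zbar\<^esub> \<partial>\<^sub>z = - cnj \<alpha> \<partial>\<^sub>z - \<alpha> \<partial>\<^sub>z\<^sub>b\<^sub>a\<^sub>r\<close> (lemma \<open>mixed_components\<close>).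
\<close>

definition connection_parameters ::
    "((complex \<Rightarrow> complex) \<Rightarrow> (complex \<Rightarrow> complex) \<Rightarrow> complex \<Rightarrow> complex)
      \<Rightarrow> (complex \<Rightarrow> complex) \<Rightarrow> (complex \<Rightarrow> complex) \<Rightarrow> bool" where
  "connection_parameters nabla \<alpha> \<beta> \<longleftrightarrow>
     (\<forall>z. complexify_connection nabla (\<lambda>_. del_z) (\<lambda>_. del_z) z =
            cscale (\<alpha> z) del_z + cscale (\<beta> z) del_zbar)"

lemma smooth_on_const: "smooth_on S (\<lambda>_. c)"
proof -
  have "C_k_on k S (\<lambda>_. c)" for k
  proof (induction k arbitrary: c)
    case (Suc k)
    have "frechet_derivative (\<lambda>_. c) (at x) = (\<lambda>_. 0)" for x :: 'a
      by (rule frechet_derivative_at [symmetric]) simp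
    then show ?case
      using Suc by simp
  qed simp
  then show ?thesis
    by (simp add: smooth_on_def)
qed

lemma mixed_components:
  assumes "symplectic_connection nabla" and "connection_parameters nabla \<alpha> \<beta>"
  shows "complexify_connection nabla (\<lambda>_. del_z) (\<lambda>_. del_zbar) z =
           cscale (- cnj (\<alpha> z)) del_z + cscale (- \<alpha> z) del_zbar"
    and "complexify_connection nabla (\<lambda>_. del_zbar) (\<lambda>_. del_z) z =
           cscale (- cnj (\<alpha> z)) del_z + cscale (- \<alpha> z) del_zbar"
    and "complexify_connection nabla (\<lambda>_. del_zbar) (\<lambda>_. del_zbar) z =
           cscale (cnj (\<beta> z)) del_z + cscale (cnj (\<alpha> z)) del_zbar"
proof -
  interpret symplectic_connection nabla by fact
  define G where "G u v = nabla (\<lambda>_. u) (\<lambda>_. v) z" for u v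
  note sm [simp] = smooth_on_const
  have d0: "frechet_derivative (\<lambda>_. c) (at x) = (\<lambda>_. 0)" for x :: complex and c :: "'b::real_normed_vector"
    by (rule frechet_derivative_at [symmetric]) simp
  have sl: "G (r *\<^sub>R u) v = r *\<^sub>R G u v" for r u v
    using fun_cong [OF scale_left [of "\<lambda>_. r" "\<lambda>_. u" "\<lambda>_. v"], of z] by (simp add: G_def)
  have sr: "G u (r *\<^sub>R v) = r *\<^sub>R G u v" for r u v
    using fun_cong [OF leibniz [of "\<lambda>_. r" "\<lambda>_. u" "\<lambda>_. v"], of z] by (simp add: G_def d0)
  have tf: "G u v = G v u" for u v
    using torsion_free [of "\<lambda>_. u" "\<lambda>_. v" z] by (simp add: G_def lie_bracket_def d0)
  have om: "omega (G u v) w + omega v (G u w) = 0" for u v w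
    using parallel_omega [of "\<lambda>_. u" "\<lambda>_. v" "\<lambda>_. w" z] by (simp add: G_def d0)
  define a b c where "a = G 1 1" and "b = G 1 \<i>" and "c = G \<i> \<i>"
  have b': "G \<i> 1 = b" using tf by (simp add: b_def)
  have half: "(1 / 2 :: complex) = (1/2) *\<^sub>R 1" "\<i> / 2 = (1/2) *\<^sub>R \<i>"
    by (simp_all add: complex_eq_iff)
  have neg: "G (- u) v = - G u v" "G u (- v) = - G u v" for u v
    using sl [of "- 1" u v] sr [of u "- 1" v] by simp_all
  have G': "G (1/2) (1/2) = a / 4" "G (1/2) (\<i>/2) = b / 4" "G (1/2) (- (\<i>/2)) = - b / 4"
    "G (\<i>/2) (1/2) = b / 4" "G (\<i>/2) (\<i>/2) = c / 4" "G (\<i>/2) (- (\<i>/2)) = - c / 4"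
    "G (- (\<i>/2)) (1/2) = - b / 4" "G (- (\<i>/2)) (\<i>/2) = - c / 4" "G (- (\<i>/2)) (- (\<i>/2)) = c / 4"
    unfolding neg half sl sr a_def [symmetric] b_def [symmetric] c_def [symmetric] b'
    by (simp_all add: scaleR_conv_of_real)
  have o1: "Re a + Im b = 0" and o2: "Re b + Im c = 0"
    using om [of 1 1 \<i>] om [of \<i> 1 \<i>] by (simp_all add: omega_def a_def b_def c_def tf [of \<i> 1])
  have p: "((a - c) / 4, - b / 2) = cscale (\<alpha> z) del_z + cscale (\<beta> z) del_zbar"
    using assms(2) unfolding connection_parameters_def
    by (auto dest!: spec [of _ z] simp: complexify_connection_def del_z_def G_def [symmetric] G'
        o_def field_simps)
  show "complexify_connection nabla (\<lambda>_. del_z) (\<lambda>_. del_zbar) z =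
           cscale (- cnj (\<alpha> z)) del_z + cscale (- \<alpha> z) del_zbar"
    and "complexify_connection nabla (\<lambda>_. del_zbar) (\<lambda>_. del_z) z =
           cscale (- cnj (\<alpha> z)) del_z + cscale (- \<alpha> z) del_zbar"
    and "complexify_connection nabla (\<lambda>_. del_zbar) (\<lambda>_. del_zbar) z =
           cscale (cnj (\<beta> z)) del_z + cscale (cnj (\<alpha> z)) del_zbar"
    using p o1 o2
    by (simp_all add: complexify_connection_def del_z_def del_zbar_def G_def [symmetric] G' o_def
        cscale_def complex_eq_iff)
qed


section \<open>The twistor space and its coordinates\<close>

text \<open>
  The fibre of the twistor space, which is the same at every point since \<open>\<omega>\<close> has constant
  coefficients.
\<close>

definition twistor_fibre :: "(complex \<Rightarrow> complex) set" where
  "twistor_fibre =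
     {j. linear j \<and> (\<forall>v. j (j v) = - v) \<and> (\<forall>u v. omega (j u) (j v) = omega u v)
         \<and> (\<forall>v. v \<noteq> 0 \<longrightarrow> omega v (j v) > 0)}"

definition has_coordinate :: "(complex \<Rightarrow> complex) \<Rightarrow> complex \<Rightarrow> bool" where
  "has_coordinate j w \<longleftrightarrow>
     {A. complexify_endo j A = cscale (- \<i>) A} = range (\<lambda>c. cscale c (del_zbar + cscale w del_z))"

definition structure_of :: "complex \<Rightarrow> complex \<Rightarrow> complex" where
  "structure_of w = (THE j. j \<in> twistor_fibre \<and> has_coordinate j w)"

text \<open>
  The definite description is justified, and \<^const>\<open>structure_of\<close> identifies the unit disc with
  the fibre.
\<close>

lemma structure_coordinate_unique:
  assumes j: "j \<in> twistor_fibre" "has_coordinate j w"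
    and j': "j' \<in> twistor_fibre" "has_coordinate j' w"
  shows "j = j'"
proof
  fix u
  have "complexify_endo j (u, j u) = cscale (- \<i>) (u, j u)"
    using j(1) by (simp add: twistor_fibre_def complexify_endo_def cscale_def)
  then have "complexify_endo j' (u, j u) = cscale (- \<i>) (u, j u)"
    using j(2) j'(2) unfolding has_coordinate_def by blast
  then show "j u = j' u"
    by (simp add: complexify_endo_def cscale_def)
qed

lemma has_coordinateI:
  assumes j: "linear j" "\<And>v. j (j v) = - v" "j (1 + w) = \<i> * (1 - w)" and w: "cmod w < 1"
  shows "has_coordinate j w"
proof -
  define p q where "p = (1 + w) / 2" and "q = \<i> * (1 - w) / 2"
  have e: "del_zbar + cscale w del_z = (p, q)"
    by (simp add: del_zbar_def del_z_def cscale_def p_def q_def complex_eq_iff field_simps)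
  have pR: "p = (1/2) *\<^sub>R (1 + w)" and qR: "q = (1/2) *\<^sub>R (\<i> * (1 - w))"
    by (simp_all add: p_def q_def scaleR_conv_of_real)
  have jp: "j p = q"
    unfolding pR qR linear_scale [OF j(1)] j(3) ..
  have jq: "j q = - p"
    using j(2) [of p] jp by simp
  have det: "Re p * Im q - Im p * Re q > 0"
  proof -
    have "Re p * Im q - Im p * Re q = (1 - (cmod w)\<^sup>2) / 4"
      unfolding cmod_power2 by (simp add: p_def q_def power2_eq_square field_simps)
    moreover have "(cmod w)\<^sup>2 < 1"
      using w by (simp add: abs_square_less_1)
    ultimately show ?thesis
      by simp
  qed
  have "\<exists>c. (u, j u) = cscale c (p, q)" for u
  proof -
    define D where "D = Re p * Im q - Im p * Re q"
    have D: "D \<noteq> 0" using det by (simp add: D_def)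
    define a where "a = (Re u * Im q - Im u * Re q) / D"
    define b where "b = (Re u * Im p - Im u * Re p) / D"
    have "Re u = a * Re p - b * Re q" "Im u = a * Im p - b * Im q"
      using D by (simp_all add: a_def b_def field_simps) (simp_all add: D_def algebra_simps)
    then have u: "u = a *\<^sub>R p - b *\<^sub>R q"
      by (simp add: complex_eq_iff)
    then have "j u = a *\<^sub>R q + b *\<^sub>R p"
      by (simp add: linear_diff [OF j(1)] linear_scale [OF j(1)] jp jq)
    with u have "(u, j u) = cscale (Complex a b) (p, q)"
      by (simp add: cscale_def)
    then show ?thesis ..
  qed
  moreover have "complexify_endo j A = cscale (- \<i>) A \<longleftrightarrow> snd A = j (fst A)" for A
    using j(2) by (cases A) (auto simp: complexify_endo_def cscale_def)
  moreover have "snd (cscale c (p, q)) = j (fst (cscale c (p, q)))" for c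
    by (simp add: cscale_def linear_diff [OF j(1)] linear_scale [OF j(1)] jp jq)
  ultimately show ?thesis
    unfolding has_coordinate_def e by (auto simp: image_iff)
qed

lemma explicit_structure:
  fixes w :: complex
  assumes w: "cmod w < 1"
  defines "j \<equiv> \<lambda>v::complex. \<i> * ((1 + (cmod w)\<^sup>2) * v - 2 * w * cnj v) / (1 - (cmod w)\<^sup>2)"
  shows "j \<in> twistor_fibre" and "has_coordinate j w"
proof -
  define r where "r = (cmod w)\<^sup>2"
  have r: "r < 1" using w by (simp add: r_def abs_square_less_1)
  have ww: "w * cnj w = of_real r" unfolding r_def by (rule complex_norm_square [symmetric])
  have r': "r = (Re w)\<^sup>2 + (Im w)\<^sup>2" by (simp add: r_def cmod_power2)
  have nz: "1 - complex_of_real r \<noteq> 0" using r by (simp add: complex_eq_iff)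
  have jr: "j v = \<i> * ((1 + of_real r) * v - 2 * w * cnj v) / (1 - of_real r)" for v
    by (simp add: j_def r_def)
  have lin: "linear j"
    by (rule linearI) (simp_all add: jr scaleR_conv_of_real algebra_simps
      add_divide_distrib diff_divide_distrib)
  have sq: "j (j v) = - v" for v
  proof -
    define k where "k = 1 - complex_of_real r"
    have k: "k * j v = \<i> * ((1 + of_real r) * v - 2 * w * cnj v)" for v
      using nz by (simp add: jr k_def)
    have ck: "k * cnj (j v) = cnj (k * j v)"
      by (simp add: k_def)
    have "k\<^sup>2 * j (j v) = k * (k * j (j v))"
      by (simp add: power2_eq_square)
    also have "\<dots> = \<i> * ((1 + of_real r) * (k * j v) - 2 * w * (k * cnj (j v)))"
      unfolding k [of "j v"] by (simp add: algebra_simps)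
    also have "\<dots> = - ((1 + of_real r)\<^sup>2 - 4 * (w * cnj w)) * v"
      unfolding ck k by (simp add: algebra_simps power2_eq_square)
    finally have "(1 - of_real r)\<^sup>2 * j (j v)
        = - ((1 + of_real r)\<^sup>2 - 4 * (w * cnj w)) * v"
      unfolding k_def .
    also have "\<dots> = (1 - of_real r)\<^sup>2 * (- v)"
      unfolding ww by (simp add: power2_eq_square algebra_simps)
    finally show ?thesis
      by (rule mult_left_cancel [THEN iffD1, rotated]) (use nz in simp)
  qed
  define A B C where "A = 1 + r" and "B = 1 - r" and "C = 2 * w"
  have B: "B > 0" using r by (simp add: B_def)
  have AC: "A\<^sup>2 - ((Re C)\<^sup>2 + (Im C)\<^sup>2) = B\<^sup>2"
    by (simp add: A_def B_def C_def r' power2_eq_square algebra_simps)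
  have Rj: "Re (j v) = (- A * Im v + Im C * Re v - Re C * Im v) / B"
    and Ij: "Im (j v) = (A * Re v - Re C * Re v - Im C * Im v) / B" for v
  proof -
    have "j v = \<i> * (of_real A * v - C * cnj v) / of_real B"
      by (simp add: jr A_def B_def C_def)
    then show "Re (j v) = (- A * Im v + Im C * Re v - Re C * Im v) / B"
      "Im (j v) = (A * Re v - Re C * Re v - Im C * Im v) / B"
      by (simp_all add: algebra_simps)
  qed
  have om: "omega (j u) (j v) = omega u v" for u v
  proof -
    have "B\<^sup>2 * omega (j u) (j v) = (A\<^sup>2 - ((Re C)\<^sup>2 + (Im C)\<^sup>2)) * omega u v"
      using B unfolding omega_def Rj Ij by (simp add: field_simps power2_eq_square)
    then show ?thesis using B by (simp add: AC)
  qed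
  have pos: "omega v (j v) > 0" if "v \<noteq> 0" for v
  proof -
    have e: "B * omega v (j v) = A * (cmod v)\<^sup>2 - Re (C * (cnj v)\<^sup>2)"
      using B unfolding omega_def Rj Ij cmod_power2 by (simp add: field_simps power2_eq_square)
    have "Re (C * (cnj v)\<^sup>2) \<le> cmod (C * (cnj v)\<^sup>2)" by (rule complex_Re_le_cmod)
    also have "\<dots> = 2 * cmod w * (cmod v)\<^sup>2" by (simp add: C_def norm_mult norm_power)
    also have "\<dots> < A * (cmod v)\<^sup>2"
    proof (rule mult_strict_right_mono)
      have "(1 - cmod w)\<^sup>2 > 0" using w by simp
      then show "2 * cmod w < A" by (simp add: A_def r_def power2_eq_square algebra_simps)
    qed (use that in simp)
    finally have "B * omega v (j v) > 0" unfolding e by simp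
    then show ?thesis using B by (simp add: zero_less_mult_iff)
  qed
  show "j \<in> twistor_fibre"
    using lin sq om pos by (simp add: twistor_fibre_def)
  have "(1 - of_real r) * j (1 + w) = \<i> * ((1 + of_real r) * (1 + w) - 2 * w * cnj (1 + w))"
    using nz by (simp only: jr) simp
  also have "\<dots> = \<i> * ((1 + of_real r) * (1 + w) - 2 * w - 2 * (w * cnj w))"
    by (simp add: algebra_simps)
  also have "\<dots> = (1 - of_real r) * (\<i> * (1 - w))"
    unfolding ww by (simp add: algebra_simps)
  finally have "j (1 + w) = \<i> * (1 - w)"
    by (rule mult_left_cancel [THEN iffD1, rotated]) (rule nz)
  then show "has_coordinate j w"
    using has_coordinateI [OF lin sq _ w] by blast
qed

lemma structure_of_unique:
  assumes "cmod w < 1"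
  shows "\<exists>!j. j \<in> twistor_fibre \<and> has_coordinate j w"
  using explicit_structure [OF assms] structure_coordinate_unique by blast

lemma twistor_fibre_has_coordinate:
  assumes j: "j \<in> twistor_fibre"
  shows "\<exists>w. cmod w < 1 \<and> has_coordinate j w"
proof -
  have lin: "linear j" and sq: "\<And>v. j (j v) = - v" and pos: "\<And>v. v \<noteq> 0 \<Longrightarrow> omega v (j v) > 0"
    using j by (auto simp: twistor_fibre_def)
  define a b c d where "a = Re (j 1)" and "b = Im (j 1)" and "c = Re (j \<i>)" and "d = Im (j \<i>)"
  have jv: "j v = Re v *\<^sub>R j 1 + Im v *\<^sub>R j \<i>" for v
  proof -
    have "v = Re v *\<^sub>R 1 + Im v *\<^sub>R \<i>" by (simp add: complex_eq_iff)
    then show ?thesis by (metis linear_add [OF lin] linear_scale [OF lin])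
  qed
  have b: "b > 0" using pos [of 1] by (simp add: omega_def b_def)
  have c: "c < 0" using pos [of \<i>] by (simp add: omega_def c_def)
  have "Re (j (j 1)) = -1" "Im (j (j 1)) = 0"
    using sq [of 1] by simp_all
  then have e1: "a * a + b * c = -1" and e2: "a * b + b * d = 0"
    unfolding jv [of "j 1"] by (simp_all add: a_def b_def c_def d_def)
  have d: "d = - a"
    using e2 b by (simp add: distrib_left [symmetric] mult.commute [of a] add_eq_0_iff)
  text \<open>Solve \<open>j (1 + w) = \<i> (1 - w)\<close> for \<open>w = x + iy\<close>.\<close>
  define s where "s = 2 + b - c"
  have s: "s > 0" using b c by (simp add: s_def)
  define x y where "x = - (b + c) / s" and "y = 2 * a / s"
  define w where "w = Complex x y"
  have n: "s\<^sup>2 * (x\<^sup>2 + y\<^sup>2) = s\<^sup>2 - 4 * s"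
  proof -
    have "s\<^sup>2 * (x\<^sup>2 + y\<^sup>2) = (s * x)\<^sup>2 + (s * y)\<^sup>2"
      by (simp add: power_mult_distrib algebra_simps)
    also have "s * x = - (b + c)"
      using s by (simp add: x_def)
    also have "s * y = 2 * a"
      using s by (simp add: y_def)
    also have "(- (b + c))\<^sup>2 + (2 * a)\<^sup>2 = (b + c)\<^sup>2 + 4 * (a * a)"
      by (simp add: power2_eq_square algebra_simps)
    also have "\<dots> = s\<^sup>2 - 4 * s"
    proof -
      have "a * a = - 1 - b * c" using e1 by simp
      then show ?thesis by (simp add: s_def power2_eq_square algebra_simps)
    qed
    finally show ?thesis .
  qed
  have w: "cmod w < 1"
  proof -
    have "s\<^sup>2 * (x\<^sup>2 + y\<^sup>2) < s\<^sup>2 * 1" unfolding n using s by simp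
    then have "x\<^sup>2 + y\<^sup>2 < 1" using s by (simp only: mult_less_cancel_left) auto
    then show ?thesis by (simp add: w_def cmod_def)
  qed
  have "s * Re (j (1 + w)) = s * Re (\<i> * (1 - w))"
  proof -
    have "s * Re (j (1 + w)) = (s + s * x) * a + (s * y) * c"
      unfolding jv [of "1 + w"] by (simp add: w_def a_def c_def algebra_simps)
    also have "\<dots> = s * y"
      using s by (simp add: x_def y_def) (simp add: s_def algebra_simps)
    finally show ?thesis by (simp add: w_def)
  qed
  moreover have "s * Im (j (1 + w)) = s * Im (\<i> * (1 - w))"
  proof -
    have "s * Im (j (1 + w)) = (s + s * x) * b + (s * y) * d"
      unfolding jv [of "1 + w"] by (simp add: w_def b_def d_def algebra_simps)
    also have "\<dots> = (s - (b + c)) * b - 2 * (a * a)"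
      using s by (simp add: x_def y_def d)
    also have "\<dots> = s - s * x"
      using s e1 by (simp add: x_def) (simp add: s_def algebra_simps)
    finally show ?thesis by (simp add: w_def algebra_simps)
  qed
  ultimately have "j (1 + w) = \<i> * (1 - w)"
    using s by (simp add: complex_eq_iff)
  then show ?thesis
    using has_coordinateI [OF lin sq _ w] w by blast
qed

lemma coordinate_unique:
  assumes "has_coordinate j w" "has_coordinate j w'"
  shows "w = w'"
proof -
  have "del_zbar + cscale w del_z = cscale 1 (del_zbar + cscale w del_z)"
    by (simp add: cscale_def prod_eq_iff)
  also have "\<dots> \<in> range (\<lambda>c. cscale c (del_zbar + cscale w' del_z))"
    using assms unfolding has_coordinate_def by blast
  finally obtain c where c:
    "del_zbar + cscale w del_z = cscale c (del_zbar + cscale w' del_z)" by auto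
  have "c = 1" "w = c * w'"
    using c by (auto simp: del_z_def del_zbar_def cscale_def complex_eq_iff algebra_simps)
  then show ?thesis by simp
qed

lemma bij_betw_structure_of: "bij_betw structure_of (ball 0 1) twistor_fibre"
proof -
  have 1: "structure_of w \<in> twistor_fibre \<and> has_coordinate (structure_of w) w" if "cmod w < 1" for w
    unfolding structure_of_def by (rule theI' [OF structure_of_unique [OF that]])
  show ?thesis
    unfolding bij_betw_def inj_on_def
  proof (intro conjI ballI impI set_eqI iffI)
    fix w w' :: complex
    assume "w \<in> ball 0 1" "w' \<in> ball 0 1" "structure_of w = structure_of w'"
    then show "w = w'" using 1 [of w] 1 [of w'] coordinate_unique by auto
  next
    fix j assume "j \<in> structure_of ` ball 0 1"
    then show "j \<in> twistor_fibre" using 1 by auto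
  next
    fix j assume j: "j \<in> twistor_fibre"
    then obtain w where "cmod w < 1" "has_coordinate j w"
      using twistor_fibre_has_coordinate by blast
    with 1 [of w] j have "j = structure_of w" "w \<in> ball 0 1"
      using structure_coordinate_unique by auto
    then show "j \<in> structure_of ` ball 0 1" by blast
  qed
qed

text \<open>
  The twistor space in the coordinates \<open>(z, w)\<close>, an open subset of \<open>\<real>\<^sup>2 \<times> \<complex>\<close>.  The projection
  \<open>\<pi>\<close> and its differential are both \<^const>\<open>fst\<close>.
\<close>

definition twistor_space :: "(complex \<times> complex) set" where
  "twistor_space = UNIV \<times> ball 0 1"

definition tautological :: "complex \<times> complex \<Rightarrow> complex \<Rightarrow> complex" where
  "tautological p = structure_of (snd p)"


section \<open>The twistor complex structure\<close>

text \<open>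
  Sections of \<open>\<pi>\<^sup>*TM\<close> are functions from the twistor space to \<^typ>\<open>complex\<close>.  In the global
  frame \<open>\<partial>\<^sub>x, \<partial>\<^sub>y\<close>, which is pulled back from \<open>M\<close>, the pullback connection differentiates the
  components of \<open>s\<close> and adds the derivative along \<open>d\<pi>(X)\<close> of the frame.  As \<open>nabla\<close> is
  \<open>C\<^sup>\<infinity>\<close>-linear in its first argument, \<open>d\<pi>(X)\<close> may be extended to a constant vector field.
\<close>

definition pullback_connection ::
    "((complex \<Rightarrow> complex) \<Rightarrow> (complex \<Rightarrow> complex) \<Rightarrow> complex \<Rightarrow> complex)
      \<Rightarrow> complex \<times> complex \<Rightarrow> complex \<times> complex \<Rightarrow> (complex \<times> complex \<Rightarrow> complex) \<Rightarrow> complex" where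
  "pullback_connection nabla p X s =
     frechet_derivative s (at p) X
       + Re (s p) *\<^sub>R nabla (\<lambda>_. fst X) (\<lambda>_. 1) (fst p)
       + Im (s p) *\<^sub>R nabla (\<lambda>_. fst X) (\<lambda>_. \<i>) (fst p)"

text \<open>The induced connection on \<open>End(\<pi>\<^sup>*TM)\<close>, as the derivative of \<open>A\<close> applied to a section \<open>s\<close>.\<close>

definition pullback_End_connection ::
    "((complex \<Rightarrow> complex) \<Rightarrow> (complex \<Rightarrow> complex) \<Rightarrow> complex \<Rightarrow> complex)
      \<Rightarrow> complex \<times> complex \<Rightarrow> complex \<times> complex \<Rightarrow> (complex \<times> complex \<Rightarrow> complex \<Rightarrow> complex)
      \<Rightarrow> (complex \<times> complex \<Rightarrow> complex) \<Rightarrow> complex" where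
  "pullback_End_connection nabla p X A s =
     pullback_connection nabla p X (\<lambda>q. A q (s q)) - A p (pullback_connection nabla p X s)"

definition horizontal ::
    "((complex \<Rightarrow> complex) \<Rightarrow> (complex \<Rightarrow> complex) \<Rightarrow> complex \<Rightarrow> complex)
      \<Rightarrow> complex \<times> complex \<Rightarrow> (complex \<times> complex) set" where
  "horizontal nabla p =
     {X. \<forall>s. smooth_on twistor_space s \<longrightarrow> pullback_End_connection nabla p X tautological s = 0}"

definition vertical :: "(complex \<times> complex) set" where
  "vertical = {X. fst X = 0}"

text \<open>A vertical vector as an endomorphism of the tangent space of \<open>M\<close>.\<close>

definition vertical_endo :: "complex \<times> complex \<Rightarrow> complex \<times> complex \<Rightarrow> complex \<Rightarrow> complex" where
  "vertical_endo p X u = frechet_derivative (\<lambda>q. tautological q u) (at p) X"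

text \<open>
  The conditions determine \<open>J\<close>: over the twistor space \<open>vertical_endo p\<close> is an isomorphism from
  \<^const>\<open>vertical\<close> onto the endomorphisms anticommuting with \<open>tautological p\<close>, and
  \<open>horizontal nabla p\<close> is a complement of \<^const>\<open>vertical\<close>.
\<close>

definition twistor_J ::
    "((complex \<Rightarrow> complex) \<Rightarrow> (complex \<Rightarrow> complex) \<Rightarrow> complex \<Rightarrow> complex)
      \<Rightarrow> complex \<times> complex \<Rightarrow> complex \<times> complex \<Rightarrow> complex \<times> complex" where
  "twistor_J nabla p =
     (THE J. linear J
        \<and> (\<forall>X \<in> horizontal nabla p.
              J X \<in> horizontal nabla p \<and> fst (J X) = tautological p (fst X))
        \<and> (\<forall>X \<in> vertical.
              J X \<in> vertical \<and> vertical_endo p (J X) = tautological p \<circ> vertical_endo p X))"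


section \<open>Holomorphic functions and sections\<close>

definition twistor_holomorphic_on ::
    "((complex \<Rightarrow> complex) \<Rightarrow> (complex \<Rightarrow> complex) \<Rightarrow> complex \<Rightarrow> complex)
      \<Rightarrow> (complex \<times> complex) set \<Rightarrow> (complex \<times> complex \<Rightarrow> complex) \<Rightarrow> bool" where
  "twistor_holomorphic_on nabla U f \<longleftrightarrow>
     (\<forall>p\<in>U. f differentiable (at p) \<and>
       (\<forall>X. frechet_derivative f (at p) (twistor_J nabla p X) = \<i> * frechet_derivative f (at p) X))"

definition twistor_section :: "(complex \<Rightarrow> complex \<times> complex) \<Rightarrow> bool" where
  "twistor_section j \<longleftrightarrow> smooth_on UNIV j \<and> (\<forall>z. j z \<in> twistor_space \<and> fst (j z) = z)"

definition holomorphic_section ::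
    "((complex \<Rightarrow> complex) \<Rightarrow> (complex \<Rightarrow> complex) \<Rightarrow> complex \<Rightarrow> complex)
      \<Rightarrow> (complex \<Rightarrow> complex \<times> complex) \<Rightarrow> bool" where
  "holomorphic_section nabla j \<longleftrightarrow>
     (\<forall>z v. frechet_derivative j (at z) (tautological (j z) v)
              = twistor_J nabla (j z) (frechet_derivative j (at z) v))"

definition wirtinger :: "(complex \<Rightarrow> complex) \<Rightarrow> complex \<Rightarrow> complex" where
  "wirtinger g z =
     (frechet_derivative g (at z) 1 - \<i> * frechet_derivative g (at z) \<i>) / 2"

definition wirtinger_bar :: "(complex \<Rightarrow> complex) \<Rightarrow> complex \<Rightarrow> complex" where
  "wirtinger_bar g z =
     (frechet_derivative g (at z) 1 + \<i> * frechet_derivative g (at z) \<i>) / 2"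

definition twistor_P ::
    "(complex \<Rightarrow> complex) \<Rightarrow> (complex \<Rightarrow> complex) \<Rightarrow> complex \<Rightarrow> complex \<Rightarrow> complex" where
  "twistor_P \<alpha> \<beta> z w = - cnj (\<beta> z) + 3 * cnj (\<alpha> z) * w - 3 * \<alpha> z * w\<^sup>2 + \<beta> z * w ^ 3"

end

theory Submission
  imports Defs
begin

text \<open>
  Everything is expressed in the coordinates \<open>(z, w)\<close>.  Write \<open>j\<^sub>w\<close> for the complex structure with
  coordinate \<open>w\<close>; it is \<open>v \<mapsto> \<i> ((1 + |w|\<^sup>2) v - 2 w cnj v) / (1 - |w|\<^sup>2)\<close>.

  On constant vector fields the connection acts at \<open>z\<close> by
  \<open>\<nabla>\<^bsub>u\<^esub> v = \<alpha> u v - cnj \<alpha> (u cnj v + cnj u v) + cnj \<beta> cnj u cnj v\<close> (\<open>nabla_constant_fields\<close>), so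
  \<open>\<nabla>\<^bsub>u\<^esub>\<close> has the form \<open>G v = a v + b cnj v\<close> with \<open>a\<close> imaginary.  The derivative of the tautological
  section along \<open>X = (u, \<eta>)\<close> is then the \<open>w\<close>-derivative of \<open>j\<^sub>w\<close> along \<open>\<eta>\<close> plus the commutator
  \<open>[G, j\<^sub>w]\<close>.  Being tangent to the orbit of \<open>j\<^sub>w\<close>, this commutator is itself a derivative of \<open>j\<^sub>w\<close>,
  along \<open>2 a w + b - cnj b w\<^sup>2\<close> (\<open>commutator_fibre_structure\<close>).  Hence \<open>X\<close> is horizontal iff
  \<open>\<eta> = h u\<close> for an explicit real linear map \<open>h\<close>, and the complex linear extension of \<open>h\<close> maps
  \<open>\<partial>\<^sub>z\<^sub>b\<^sub>a\<^sub>r + w \<partial>\<^sub>z\<close> to the polynomial \<open>P\<close> (\<open>horizontal_lift_eq_twistor_P\<close>).  On vertical vectors, left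
  multiplication by \<open>j\<^sub>w\<close> is multiplication of \<open>\<eta>\<close> by \<open>\<i>\<close> (\<open>fibre_structure_deriv_mult_ii\<close>).
  Therefore (\<open>twistor_J_eq\<close>)
  \<open>J (u, \<eta>) = (j\<^sub>w u, h (j\<^sub>w u) + \<i> (\<eta> - h u))\<close>.

  Both assertions now reduce to one fact (\<open>fibre_structure_holomorphic_iff\<close>): a real linear map
  \<open>F u = a u + b cnj u\<close> satisfies \<open>F \<circ> j\<^sub>w = \<i> F\<close> iff it annihilates the \<open>(0,1)\<close>-vector
  \<open>\<partial>\<^sub>z\<^sub>b\<^sub>a\<^sub>r + w \<partial>\<^sub>z\<close>, that is, iff \<open>b + w a = 0\<close>.  For functions \<open>F\<close> is the differential on
  horizontal lifts, while the vertical directions yield \<open>\<partial>f/\<partial>w\<^sub>b\<^sub>a\<^sub>r = 0\<close>.  For sections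
  \<open>F\<close> is the vertical part \<open>dw - h\<close> of the differential of \<open>z \<mapsto> (z, w z)\<close>.
\<close>

section \<open>The complex structures of the fibre\<close>

text \<open>
  The element of the fibre with coordinate \<open>w\<close> in closed form; on the unit disc it agrees with
  \<^const>\<open>structure_of\<close> (\<open>structure_of_eq\<close> below).  Real endomorphisms of the plane are written in
  the form \<open>v \<mapsto> a v + b cnj v\<close>, and \<open>|w|\<^sup>2\<close> as \<open>w * cnj w\<close>, so that identities between them are
  polynomial identities in \<open>w\<close>, \<open>v\<close> and their conjugates.
\<close>

definition fibre_structure :: "complex \<Rightarrow> complex \<Rightarrow> complex" where
  "fibre_structure w v = \<i> * ((1 + w * cnj w) * v - 2 * w * cnj v) / (1 - w * cnj w)"

text \<open>The derivative of \<open>\<lambda>w. fibre_structure w v\<close> at \<open>w\<close> in the direction \<open>\<eta>\<close>, for \<open>|w| < 1\<close>.\<close>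

definition fibre_structure_deriv :: "complex \<Rightarrow> complex \<Rightarrow> complex \<Rightarrow> complex" where
  "fibre_structure_deriv w \<eta> v =
     2 * \<i> * ((cnj w * \<eta> + w * cnj \<eta>) * v - (\<eta> + w\<^sup>2 * cnj \<eta>) * cnj v) / (1 - w * cnj w)\<^sup>2"

lemma disc_denominator_nonzero:
  assumes "cmod w < 1"
  shows "1 - w * cnj w \<noteq> 0"
proof
  assume "1 - w * cnj w = 0"
  then have "complex_of_real ((cmod w)\<^sup>2) = 1"
    by (simp only: complex_norm_square) simp
  then have "(cmod w)\<^sup>2 = 1"
    using of_real_eq_1_iff by blast
  with assms show False
    using norm_ge_zero [of w] by (simp add: power2_eq_1_iff)
qed

lemma structure_of_eq:
  assumes "cmod w < 1"
  shows "structure_of w = fibre_structure w"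
proof -
  have eq: "fibre_structure w =
      (\<lambda>v::complex. \<i> * ((1 + (cmod w)\<^sup>2) * v - 2 * w * cnj v) / (1 - (cmod w)\<^sup>2))"
    by (simp add: fun_eq_iff fibre_structure_def flip: complex_norm_square)
  have "fibre_structure w \<in> twistor_fibre \<and> has_coordinate (fibre_structure w) w"
    using explicit_structure [OF assms] by (simp only: eq)
  then show ?thesis
    unfolding structure_of_def using structure_of_unique [OF assms] by (blast intro: the1_equality)
qed

lemma tautological_eq:
  "p \<in> twistor_space \<Longrightarrow> tautological p = fibre_structure (snd p)"
  by (auto simp: tautological_def twistor_space_def structure_of_eq)

lemma open_twistor_space: "open twistor_space"
  unfolding twistor_space_def by (intro open_Times) auto

lemma linear_fibre_structure: "linear (fibre_structure w)"
  by (rule linearI)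
    (simp_all add: fibre_structure_def scaleR_conv_of_real algebra_simps add_divide_distrib
      diff_divide_distrib)

lemma linear_fibre_structure_deriv: "linear (\<lambda>\<eta>. fibre_structure_deriv w \<eta> v)"
  by (rule linearI)
    (simp_all add: fibre_structure_deriv_def scaleR_conv_of_real algebra_simps add_divide_distrib
      diff_divide_distrib)

lemma has_derivative_fibre_structure:
  assumes w: "cmod w < 1" and s: "(s has_derivative s') (at (z, w))"
  shows "((\<lambda>q. fibre_structure (snd q) (s q)) has_derivative
           (\<lambda>X. fibre_structure_deriv w (snd X) (s (z, w)) + fibre_structure w (s' X))) (at (z, w))"
proof -
  define n where "n = 1 - w * cnj w"
  have nz: "n \<noteq> 0"
    using disc_denominator_nonzero [OF w] by (simp add: n_def)
  define v where "v = s (z, w)"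
  define N where "N q = \<i> * ((1 + snd q * cnj (snd q)) * s q - 2 * snd q * cnj (s q))" for q
  define r' where "r' \<eta> = cnj w * \<eta> + w * cnj \<eta>" for \<eta>
  define N' where "N' X = \<i> * (r' (snd X) * v + (1 + w * cnj w) * s' X
      - 2 * snd X * cnj v - 2 * w * cnj (s' X))" for X
  have dN: "(N has_derivative N') (at (z, w))"
    unfolding N_def N'_def r'_def v_def
    by (auto intro!: derivative_eq_intros s simp: algebra_simps)
  have dn: "((\<lambda>q. 1 - snd q * cnj (snd q)) has_derivative (\<lambda>X. - r' (snd X))) (at (z, w))"
    unfolding r'_def by (auto intro!: derivative_eq_intros simp: algebra_simps)
  have "((\<lambda>q. fibre_structure (snd q) (s q)) has_derivative
      (\<lambda>X. (N' X * n - N (z, w) * - r' (snd X)) / (n * n))) (at (z, w))"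
    using has_derivative_divide' [OF dN dn] nz by (simp add: fibre_structure_def N_def n_def)
  moreover have "(N' X * n - N (z, w) * - r' (snd X)) / (n * n) =
      fibre_structure_deriv w (snd X) v + fibre_structure w (s' X)" for X
  proof -
    define M where "M = (cnj w * snd X + w * cnj (snd X)) * v
        - (snd X + w\<^sup>2 * cnj (snd X)) * cnj v"
    define S where "S = (1 + w * cnj w) * s' X - 2 * w * cnj (s' X)"
    have "N' X * n - N (z, w) * - r' (snd X) = 2 * \<i> * M + \<i> * S * n"
      by (simp add: N'_def N_def M_def S_def r'_def n_def v_def power2_eq_square algebra_simps)
    then have "(N' X * n - N (z, w) * - r' (snd X)) / (n * n) = 2 * \<i> * M / n\<^sup>2 + \<i> * S / n"
      using nz by (simp add: add_divide_distrib power2_eq_square)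
    then show ?thesis
      by (simp add: fibre_structure_deriv_def fibre_structure_def M_def S_def n_def)
  qed
  ultimately show ?thesis
    by (simp add: v_def)
qed

text \<open>
  The coordinate \<open>w\<close> immerses the disc into the endomorphisms: as \<open>\<eta>\<close> is a multiple of
  \<open>(\<eta> + w\<^sup>2 cnj \<eta>) - w (cnj w \<eta> + w cnj \<eta>)\<close>, it is determined by the two coefficients of
  the derivative.
\<close>

lemma fibre_structure_deriv_inject:
  assumes w: "cmod w < 1" and z: "\<And>v. fibre_structure_deriv w \<eta> v = 0"
  shows "\<eta> = 0"
proof -
  note nz = disc_denominator_nonzero [OF w]
  have 1: "(cnj w * \<eta> + w * cnj \<eta>) = \<eta> + w\<^sup>2 * cnj \<eta>"
    using z [of 1] nz by (simp add: fibre_structure_deriv_def)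
  have 2: "(cnj w * \<eta> + w * cnj \<eta>) = - (\<eta> + w\<^sup>2 * cnj \<eta>)"
  proof -
    have "2 * \<i> * (\<i> * (cnj w * \<eta> + w * cnj \<eta>) + \<i> * (\<eta> + w\<^sup>2 * cnj \<eta>)) = 0"
      using z [of \<i>] nz by (simp add: fibre_structure_deriv_def mult.commute)
    then have "(cnj w * \<eta> + w * cnj \<eta>) + (\<eta> + w\<^sup>2 * cnj \<eta>) = 0"
      by (simp flip: distrib_left)
    then show ?thesis
      by (simp only: eq_neg_iff_add_eq_0)
  qed
  have cancel: "B = 0 \<and> A = 0" if "A = B" "A = - B" for A B :: complex
    using that by simp
  have 0: "\<eta> + w\<^sup>2 * cnj \<eta> = 0" "cnj w * \<eta> + w * cnj \<eta> = 0"
    using cancel [OF 1 2] by simp_all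
  have "\<eta> * (1 - w * cnj w) = (\<eta> + w\<^sup>2 * cnj \<eta>) - w * (cnj w * \<eta> + w * cnj \<eta>)"
    by (simp add: algebra_simps power2_eq_square)
  then have "\<eta> * (1 - w * cnj w) = 0"
    unfolding 0 by simp
  with nz show ?thesis by simp
qed

text \<open>
  The fibrewise complex structure, left multiplication by the point itself, is the standard one of
  the disc.
\<close>

lemma fibre_structure_deriv_mult_ii:
  assumes w: "cmod w < 1"
  shows "fibre_structure_deriv w (\<i> * \<eta>) v = fibre_structure w (fibre_structure_deriv w \<eta> v)"
proof -
  define n where "n = 1 - w * cnj w"
  have nz: "n \<noteq> 0"
    using disc_denominator_nonzero [OF w] by (simp add: n_def)
  have cn: "cnj n = n"
    by (simp add: n_def mult.commute)
  define K where "K \<xi> = 2 * \<i> * ((cnj w * \<xi> + w * cnj \<xi>) * v - (\<xi> + w\<^sup>2 * cnj \<xi>) * cnj v)" for \<xi>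
  have D: "fibre_structure_deriv w \<xi> v = K \<xi> / n\<^sup>2" for \<xi>
    by (simp add: fibre_structure_deriv_def K_def n_def)
  have "\<i> * ((1 + w * cnj w) * K \<eta> - 2 * w * cnj (K \<eta>)) = K (\<i> * \<eta>) * n"
    by (simp add: K_def n_def power2_eq_square algebra_simps)
  moreover have "fibre_structure w (K \<eta> / n\<^sup>2) =
      \<i> * ((1 + w * cnj w) * K \<eta> - 2 * w * cnj (K \<eta>)) / (n * n\<^sup>2)"
    by (simp add: fibre_structure_def cn diff_divide_distrib right_diff_distrib mult.commute
        flip: n_def)
  ultimately show ?thesis
    using nz by (simp add: D)
qed

text \<open>
  An endomorphism \<open>v \<mapsto> a v + b cnj v\<close> with \<open>a\<close> imaginary lies in the symplectic Lie algebra, so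
  its commutator with \<open>fibre_structure w\<close> is tangent to the fibre.  The right-hand side contains
  the infinitesimal action of the endomorphism on the coordinate \<open>w\<close>.
\<close>

lemma commutator_fibre_structure:
  fixes a b w :: complex
  assumes w: "cmod w < 1" and a: "cnj a = - a"
  defines "G \<equiv> \<lambda>v. a * v + b * cnj v"
  shows "G (fibre_structure w v) - fibre_structure w (G v) =
           fibre_structure_deriv w (2 * a * w + b - cnj b * w\<^sup>2) v"
proof -
  define n where "n = 1 - w * cnj w"
  have nz: "n \<noteq> 0"
    using disc_denominator_nonzero [OF w] by (simp add: n_def)
  have cn: "cnj n = n"
    by (simp add: n_def mult.commute)
  define N where "N v = \<i> * ((1 + w * cnj w) * v - 2 * w * cnj v)" for v
  define \<eta> where "\<eta> = 2 * a * w + b - cnj b * w\<^sup>2"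
  have "a * N v + b * cnj (N v) - N (G v) =
      2 * \<i> * ((cnj b * w + b * cnj w) * v - (2 * a * w + b * (1 + w * cnj w)) * cnj v)"
    by (simp add: N_def G_def a algebra_simps)
  moreover have "(cnj w * \<eta> + w * cnj \<eta>) = (cnj b * w + b * cnj w) * n"
    and "\<eta> + w\<^sup>2 * cnj \<eta> = (2 * a * w + b * (1 + w * cnj w)) * n"
    by (simp_all add: \<eta>_def n_def a power2_eq_square algebra_simps)
  ultimately have "(a * N v + b * cnj (N v) - N (G v)) * n =
      2 * \<i> * ((cnj w * \<eta> + w * cnj \<eta>) * v - (\<eta> + w\<^sup>2 * cnj \<eta>) * cnj v)"
    by (simp only: left_diff_distrib right_diff_distrib mult.assoc mult.left_commute mult.commute)
  then have "fibre_structure_deriv w \<eta> v = (a * N v + b * cnj (N v) - N (G v)) * n / n\<^sup>2"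
    by (simp add: fibre_structure_deriv_def n_def)
  also have "\<dots> = (a * N v + b * cnj (N v) - N (G v)) / n"
    using nz by (simp add: power2_eq_square)
  also have "\<dots> = G (N v / n) - N (G v) / n"
    by (simp add: G_def cn add_divide_distrib diff_divide_distrib)
  also have "\<dots> = G (fibre_structure w v) - fibre_structure w (G v)"
    by (simp add: fibre_structure_def N_def n_def)
  finally show ?thesis
    by (simp add: \<eta>_def)
qed

text \<open>
  A real linear map into \<open>\<complex>\<close> is complex linear for the structure with coordinate \<open>w\<close> iff it kills the
  vector \<open>\<partial>\<^sub>z\<^sub>b\<^sub>a\<^sub>r + w \<partial>\<^sub>z\<close>.
\<close>

lemma fibre_structure_holomorphic_iff:
  fixes a b w :: complex
  assumes w: "cmod w < 1"
  defines "F \<equiv> \<lambda>u. a * u + b * cnj u"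
  shows "(\<forall>u. F (fibre_structure w u) = \<i> * F u) \<longleftrightarrow> b + w * a = 0"
proof -
  define n where "n = 1 - w * cnj w"
  have nz: "n \<noteq> 0"
    using disc_denominator_nonzero [OF w] by (simp add: n_def)
  have cn: "cnj n = n"
    by (simp add: n_def mult.commute)
  have F: "F (fibre_structure w u) - \<i> * F u = 2 * \<i> * (b + w * a) * (cnj w * u - cnj u) / n" for u
  proof -
    define N where "N = \<i> * ((1 + w * cnj w) * u - 2 * w * cnj u)"
    have "F (fibre_structure w u) - \<i> * F u = a * (N / n) + b * (cnj N / n) - \<i> * F u * n / n"
      using nz by (simp add: F_def fibre_structure_def N_def cn flip: n_def)
    also have "\<dots> = (a * N + b * cnj N - \<i> * F u * n) / n"
      by (simp add: add_divide_distrib diff_divide_distrib)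
    also have "a * N + b * cnj N - \<i> * F u * n = 2 * \<i> * (b + w * a) * (cnj w * u - cnj u)"
      by (simp add: N_def F_def n_def algebra_simps)
    finally show ?thesis .
  qed
  have "cnj w \<noteq> 1"
    using w by auto
  then have "F (fibre_structure w 1) - \<i> * F 1 = 0 \<Longrightarrow> b + w * a = 0"
    unfolding F using nz by simp
  moreover have "b + w * a = 0 \<Longrightarrow> F (fibre_structure w u) - \<i> * F u = 0" for u
    unfolding F by simp
  ultimately show ?thesis
    by (metis eq_iff_diff_eq_0)
qed

section \<open>The horizontal distribution\<close>

lemma smooth_on_imp_differentiable:
  "smooth_on S f \<Longrightarrow> x \<in> S \<Longrightarrow> f differentiable (at x)"
  unfolding smooth_on_def by (metis C_k_on.simps(2))

lemma nabla_constant_fields: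
  assumes "symplectic_connection nabla" and "connection_parameters nabla \<alpha> \<beta>"
  shows "nabla (\<lambda>_. u) (\<lambda>_. v) z =
           \<alpha> z * u * v - cnj (\<alpha> z) * (u * cnj v + cnj u * v) + cnj (\<beta> z) * cnj u * cnj v"
proof -
  interpret symplectic_connection nabla by fact
  define G where "G u v = nabla (\<lambda>_. u) (\<lambda>_. v) z" for u v
  note sm [simp] = smooth_on_const
  have d0: "frechet_derivative (\<lambda>_. c) (at x) = (\<lambda>_. 0)" for x :: complex and c :: "'b::real_normed_vector"
    by (rule frechet_derivative_at [symmetric]) simp
  have sl: "G (r *\<^sub>R u) v = r *\<^sub>R G u v" for r u v
    using fun_cong [OF scale_left [of "\<lambda>_. r" "\<lambda>_. u" "\<lambda>_. v"], of z] by (simp add: G_def)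
  have sr: "G u (r *\<^sub>R v) = r *\<^sub>R G u v" for r u v
    using fun_cong [OF leibniz [of "\<lambda>_. r" "\<lambda>_. u" "\<lambda>_. v"], of z] by (simp add: G_def d0)
  have al: "G (u + u') v = G u v + G u' v" for u u' v
    using fun_cong [OF add_left [of "\<lambda>_. u" "\<lambda>_. u'" "\<lambda>_. v"], of z] by (simp add: G_def)
  have ar: "G u (v + v') = G u v + G u v'" for u v v'
    using fun_cong [OF add_right [of "\<lambda>_. u" "\<lambda>_. v" "\<lambda>_. v'"], of z] by (simp add: G_def)
  have half: "(1 / 2 :: complex) = (1/2) *\<^sub>R 1" "\<i> / 2 = (1/2) *\<^sub>R \<i>" "- ((1/2) *\<^sub>R \<i>) = (-1/2) *\<^sub>R \<i>"
    by (simp_all add: complex_eq_iff)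
  have p: "complexify_connection nabla (\<lambda>_. del_z) (\<lambda>_. del_z) z =
      cscale (\<alpha> z) del_z + cscale (\<beta> z) del_zbar"
    using assms(2) by (simp add: connection_parameters_def)
  note m = p mixed_components [OF assms, of z]
  have frame: "G 1 1 = \<alpha> z - 2 * cnj (\<alpha> z) + cnj (\<beta> z)" "G 1 \<i> = \<i> * \<alpha> z - \<i> * cnj (\<beta> z)"
    "G \<i> 1 = \<i> * \<alpha> z - \<i> * cnj (\<beta> z)" "G \<i> \<i> = - \<alpha> z - 2 * cnj (\<alpha> z) - cnj (\<beta> z)"
    using m unfolding complexify_connection_def o_def del_z_def del_zbar_def fst_conv snd_conv
      G_def [symmetric] half sl sr
    by (auto simp: cscale_def complex_eq_iff)
  have dec: "x = Re x *\<^sub>R 1 + Im x *\<^sub>R \<i>" for x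
    by (simp add: complex_eq_iff)
  have "G u v = Re u *\<^sub>R (Re v *\<^sub>R G 1 1 + Im v *\<^sub>R G 1 \<i>)
       + Im u *\<^sub>R (Re v *\<^sub>R G \<i> 1 + Im v *\<^sub>R G \<i> \<i>)"
    by (subst dec [of u], subst dec [of v]) (simp add: al ar sl sr algebra_simps)
  then have "G u v = \<alpha> z * u * v - cnj (\<alpha> z) * (u * cnj v + cnj u * v) + cnj (\<beta> z) * cnj u * cnj v"
    unfolding frame by (simp add: complex_eq_iff algebra_simps)
  then show ?thesis
    by (simp add: G_def)
qed

text \<open>
  The \<open>w\<close>-component of the horizontal lift of \<open>u\<close> to the point \<open>p = (z, w)\<close>; it is
  \<open>- (2 a w + b - cnj b w\<^sup>2)\<close> when \<open>\<nabla>\<^bsub>u\<^esub>\<close> acts on constant vector fields by \<open>v \<mapsto> a v + b cnj v\<close>.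
\<close>

definition horizontal_lift ::
    "(complex \<Rightarrow> complex) \<Rightarrow> (complex \<Rightarrow> complex) \<Rightarrow> complex \<times> complex \<Rightarrow> complex \<Rightarrow> complex" where
  "horizontal_lift \<alpha> \<beta> p u =
     (let z = fst p; w = snd p in
        (cnj (\<alpha> z) - 2 * \<alpha> z * w + \<beta> z * w\<^sup>2) * u
        + (- cnj (\<beta> z) + 2 * cnj (\<alpha> z) * w - \<alpha> z * w\<^sup>2) * cnj u)"

lemma linear_horizontal_lift: "linear (horizontal_lift \<alpha> \<beta> p)"
  by (rule linearI) (simp_all add: horizontal_lift_def Let_def scaleR_conv_of_real algebra_simps)

text \<open>
  The value at \<open>p\<close> depends on \<open>s\<close> only through \<open>s p\<close>: the derivative of \<open>s\<close> cancels, as it must for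
  a connection on endomorphisms.
\<close>

lemma pullback_End_connection_tautological:
  assumes "symplectic_connection nabla" and "connection_parameters nabla \<alpha> \<beta>"
    and p: "p \<in> twistor_space" and s: "s differentiable (at p)"
  shows "pullback_End_connection nabla p X tautological s =
           fibre_structure_deriv (snd p) (snd X - horizontal_lift \<alpha> \<beta> p (fst X)) (s p)"
proof -
  obtain z w where pzw: "p = (z, w)" by (cases p)
  have w: "cmod w < 1" using p by (simp add: pzw twistor_space_def)
  define u where "u = fst X"
  define a where "a = \<alpha> z * u - cnj (\<alpha> z) * cnj u"
  define b where "b = - cnj (\<alpha> z) * u + cnj (\<beta> z) * cnj u"
  define s' where "s' = frechet_derivative s (at p)"
  have s': "(s has_derivative s') (at (z, w))"
    using s unfolding s'_def pzw by (simp add: frechet_derivative_works)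
  have G: "Re v *\<^sub>R nabla (\<lambda>_. fst X) (\<lambda>_. 1) (fst p) + Im v *\<^sub>R nabla (\<lambda>_. fst X) (\<lambda>_. \<i>) (fst p)
      = a * v + b * cnj v" for v
    unfolding nabla_constant_fields [OF assms(1,2)]
    by (simp add: pzw u_def a_def b_def complex_eq_iff algebra_simps)
  have pc: "pullback_connection nabla p X t =
      frechet_derivative t (at p) X + (a * t p + b * cnj (t p))" for t
    using G [of "t p"] by (simp add: pullback_connection_def)
  have "((\<lambda>q. tautological q (s q)) has_derivative
      (\<lambda>X. fibre_structure_deriv w (snd X) (s p) + fibre_structure w (s' X))) (at p)"
    using has_derivative_fibre_structure [OF w s'] open_twistor_space p unfolding pzw
    by (rule has_derivative_transform_within_open) (simp add: tautological_eq)
  then have "frechet_derivative (\<lambda>q. tautological q (s q)) (at p) X =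
      fibre_structure_deriv w (snd X) (s p) + fibre_structure w (s' X)"
    by (simp add: frechet_derivative_at [symmetric])
  then have "pullback_End_connection nabla p X tautological s =
      fibre_structure_deriv w (snd X) (s p)
      + ((a * fibre_structure w (s p) + b * cnj (fibre_structure w (s p)))
          - fibre_structure w (a * s p + b * cnj (s p)))"
    unfolding pullback_End_connection_def pc tautological_eq [OF p]
    by (simp add: pzw linear_add [OF linear_fibre_structure] s'_def)
  also have "\<dots> = fibre_structure_deriv w (snd X) (s p)
      + fibre_structure_deriv w (2 * a * w + b - cnj b * w\<^sup>2) (s p)"
    by (subst commutator_fibre_structure [OF w]) (simp_all add: a_def)
  also have "2 * a * w + b - cnj b * w\<^sup>2 = - horizontal_lift \<alpha> \<beta> p (fst X)"
    by (simp add: a_def b_def horizontal_lift_def pzw u_def algebra_simps)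
  finally show ?thesis
    by (simp add: pzw linear_add [OF linear_fibre_structure_deriv, symmetric])
qed

lemma horizontal_eq:
  assumes "symplectic_connection nabla" and "connection_parameters nabla \<alpha> \<beta>"
    and p: "p \<in> twistor_space"
  shows "horizontal nabla p = {X. snd X = horizontal_lift \<alpha> \<beta> p (fst X)}"
proof -
  have w: "cmod (snd p) < 1" using p by (auto simp: twistor_space_def)
  note e = pullback_End_connection_tautological [OF assms]
  have "snd X = horizontal_lift \<alpha> \<beta> p (fst X)" if "X \<in> horizontal nabla p" for X
  proof -
    have "fibre_structure_deriv (snd p) (snd X - horizontal_lift \<alpha> \<beta> p (fst X)) v = 0" for v
      using that e [of "\<lambda>_. v" X] by (simp add: horizontal_def smooth_on_const)
    from fibre_structure_deriv_inject [OF w this] show ?thesis by simp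
  qed
  moreover have "X \<in> horizontal nabla p" if "snd X = horizontal_lift \<alpha> \<beta> p (fst X)" for X
    using that p by (auto simp: horizontal_def e smooth_on_imp_differentiable
        linear_0 [OF linear_fibre_structure_deriv])
  ultimately show ?thesis by blast
qed

section \<open>The twistor complex structure in coordinates\<close>

lemma vertical_endo_eq:
  assumes p: "p \<in> twistor_space"
  shows "vertical_endo p X = fibre_structure_deriv (snd p) (snd X)"
proof
  fix v
  have w: "cmod (snd p) < 1" using p by (auto simp: twistor_space_def)
  have "((\<lambda>q. fibre_structure (snd q) v) has_derivative
      (\<lambda>X. fibre_structure_deriv (snd p) (snd X) v)) (at p)"
    using has_derivative_fibre_structure [OF w has_derivative_const, of v "fst p"]
    by (simp add: linear_0 [OF linear_fibre_structure])
  then have "((\<lambda>q. tautological q v) has_derivative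
      (\<lambda>X. fibre_structure_deriv (snd p) (snd X) v)) (at p)"
    using open_twistor_space p
    by (rule has_derivative_transform_within_open) (simp add: tautological_eq)
  then show "vertical_endo p X v = fibre_structure_deriv (snd p) (snd X) v"
    by (simp add: vertical_endo_def frechet_derivative_at [symmetric])
qed

lemma twistor_J_eq:
  assumes "symplectic_connection nabla" and "connection_parameters nabla \<alpha> \<beta>"
    and p: "p \<in> twistor_space"
  defines "j \<equiv> fibre_structure (snd p)" and "h \<equiv> horizontal_lift \<alpha> \<beta> p"
  shows "twistor_J nabla p X = (j (fst X), h (j (fst X)) + \<i> * (snd X - h (fst X)))"
proof -
  have w: "cmod (snd p) < 1" using p by (auto simp: twistor_space_def)
  have lj: "linear j" and lh: "linear h"
    by (simp_all add: j_def h_def linear_fibre_structure linear_horizontal_lift)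
  note hor = horizontal_eq [OF assms(1,2) p, folded h_def]
  note taut = tautological_eq [OF p, folded j_def]
  note ver = vertical_endo_eq [OF p]
  define J where "J X = (j (fst X), h (j (fst X)) + \<i> * (snd X - h (fst X)))"
    for X :: "complex \<times> complex"
  define is_J where "is_J J \<longleftrightarrow> linear J
        \<and> (\<forall>X \<in> horizontal nabla p.
              J X \<in> horizontal nabla p \<and> fst (J X) = tautological p (fst X))
        \<and> (\<forall>X \<in> vertical.
              J X \<in> vertical \<and> vertical_endo p (J X) = tautological p \<circ> vertical_endo p X)" for J
  have "linear J"
    by (rule linearI) (simp_all add: J_def linear_add [OF lj] linear_add [OF lh]
        linear_scale [OF lj] linear_scale [OF lh] algebra_simps)
  then have 1: "is_J J"
    by (auto simp: is_J_def hor taut ver vertical_def J_def linear_0 [OF lj] linear_0 [OF lh]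
        fun_eq_iff fibre_structure_deriv_mult_ii [OF w] j_def [symmetric])
  have 2: "J' = J" if J': "is_J J'" for J'
  proof
    fix X :: "complex \<times> complex"
    \<comment> \<open>\<open>X\<close> is the sum of a horizontal vector and \<open>(0, \<xi>)\<close>; the conditions fix \<open>J'\<close> on both.\<close>
    define \<xi> where "\<xi> = snd X - h (fst X)"
    have "(fst X, h (fst X)) \<in> horizontal nabla p"
      by (simp add: hor)
    then have H: "J' (fst X, h (fst X)) = (j (fst X), h (j (fst X)))"
      using J' by (auto simp: is_J_def hor taut prod_eq_iff)
    have "(0, \<xi>) \<in> vertical"
      by (simp add: vertical_def)
    then have f: "fst (J' (0, \<xi>)) = 0"
      and "fibre_structure_deriv (snd p) (snd (J' (0, \<xi>)))
        = j \<circ> fibre_structure_deriv (snd p) \<xi>"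
      using J' by (auto simp: is_J_def vertical_def taut ver)
    then have "fibre_structure_deriv (snd p) (snd (J' (0, \<xi>)) - \<i> * \<xi>) v = 0" for v
      by (simp add: linear_diff [OF linear_fibre_structure_deriv] fibre_structure_deriv_mult_ii [OF w]
          j_def fun_eq_iff)
    from fibre_structure_deriv_inject [OF w this] f have V: "J' (0, \<xi>) = (0, \<i> * \<xi>)"
      by (simp add: prod_eq_iff)
    have "X = (fst X, h (fst X)) + (0, \<xi>)"
      by (simp add: \<xi>_def prod_eq_iff)
    then have "J' X = J' (fst X, h (fst X)) + J' (0, \<xi>)"
      using J' by (metis is_J_def linear_add)
    then show "J' X = J X"
      by (simp add: H V J_def flip: \<xi>_def)
  qed
  have "twistor_J nabla p = J"
    unfolding twistor_J_def is_J_def [symmetric] using 1 2 by (rule the_equality)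
  then show ?thesis
    by (simp add: J_def)
qed

section \<open>Holomorphic functions and sections\<close>

lemma wirtinger_expansion:
  assumes "(g has_derivative g') (at z)"
  shows "g' v = wirtinger g z * v + wirtinger_bar g z * cnj v"
proof -
  have fd: "frechet_derivative g (at z) = g'"
    using frechet_derivative_at [OF assms] ..
  have l: "linear g'"
    using assms by (rule has_derivative_linear)
  have "v = Re v *\<^sub>R 1 + Im v *\<^sub>R \<i>"
    by (simp add: complex_eq_iff)
  then have "g' v = Re v *\<^sub>R g' 1 + Im v *\<^sub>R g' \<i>"
    by (metis linear_add [OF l] linear_scale [OF l])
  then show ?thesis
    unfolding wirtinger_def wirtinger_bar_def fd by (simp add: complex_eq_iff field_simps)
qed

text \<open>
  If \<open>k\<close> denotes the coefficient of \<open>u\<close> in the lift, the coefficient of \<open>cnj u\<close> is \<open>P - w k\<close>.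
  Thus the complexified lift takes the value \<open>P\<close> at \<open>\<partial>\<^sub>z\<^sub>b\<^sub>a\<^sub>r + w \<partial>\<^sub>z\<close>, that is, at
  \<open>u = w\<close>, \<open>cnj u = 1\<close> with \<open>u\<close> and \<open>cnj u\<close> treated as independent.
\<close>

lemma horizontal_lift_eq_twistor_P:
  "horizontal_lift \<alpha> \<beta> (z, w) u =
     (cnj (\<alpha> z) - 2 * \<alpha> z * w + \<beta> z * w\<^sup>2) * u
     + (twistor_P \<alpha> \<beta> z w - w * (cnj (\<alpha> z) - 2 * \<alpha> z * w + \<beta> z * w\<^sup>2)) * cnj u"
  by (simp add: horizontal_lift_def twistor_P_def power2_eq_square power3_eq_cube algebra_simps)

lemma twistor_holomorphic_at_iff:
  assumes "symplectic_connection nabla" and "connection_parameters nabla \<alpha> \<beta>"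
    and w: "cmod w < 1" and f: "f differentiable (at (z, w))"
  shows "(\<forall>X. frechet_derivative f (at (z, w)) (twistor_J nabla (z, w) X)
                = \<i> * frechet_derivative f (at (z, w)) X) \<longleftrightarrow>
           wirtinger_bar (\<lambda>\<eta>. f (z, \<eta>)) w = 0 \<and>
           wirtinger_bar (\<lambda>\<zeta>. f (\<zeta>, w)) z + w * wirtinger (\<lambda>\<zeta>. f (\<zeta>, w)) z
             + twistor_P \<alpha> \<beta> z w * wirtinger (\<lambda>\<eta>. f (z, \<eta>)) w = 0"
    (is "?L \<longleftrightarrow> ?R")
proof -
  define A B C E where "A = wirtinger (\<lambda>\<zeta>. f (\<zeta>, w)) z" and "B = wirtinger_bar (\<lambda>\<zeta>. f (\<zeta>, w)) z"
    and "C = wirtinger (\<lambda>\<eta>. f (z, \<eta>)) w" and "E = wirtinger_bar (\<lambda>\<eta>. f (z, \<eta>)) w"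
  define f' where "f' = frechet_derivative f (at (z, w))"
  define j where "j = fibre_structure w"
  define h where "h = horizontal_lift \<alpha> \<beta> (z, w)"
  define k where "k = cnj (\<alpha> z) - 2 * \<alpha> z * w + \<beta> z * w\<^sup>2"
  define P where "P = twistor_P \<alpha> \<beta> z w"
  have J: "twistor_J nabla (z, w) X = (j (fst X), h (j (fst X)) + \<i> * (snd X - h (fst X)))" for X
    using twistor_J_eq [OF assms(1,2), of "(z, w)"] w by (simp add: twistor_space_def j_def h_def)
  have h: "h u = k * u + (P - w * k) * cnj u" for u
    unfolding h_def k_def P_def by (rule horizontal_lift_eq_twistor_P)
  have f': "(f has_derivative f') (at (z, w))"
    using f unfolding f'_def by (simp add: frechet_derivative_works)
  have "((\<lambda>\<zeta>. f (\<zeta>, w)) has_derivative (\<lambda>u. f' (u, 0))) (at z)"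
    by (rule has_derivative_compose [where g = f and f = "\<lambda>\<zeta>. (\<zeta>, w)", OF _ f'])
      (intro has_derivative_Pair has_derivative_ident has_derivative_const)
  from wirtinger_expansion [OF this] have 1: "f' (u, 0) = A * u + B * cnj u" for u
    by (simp add: A_def B_def)
  have "((\<lambda>\<eta>. f (z, \<eta>)) has_derivative (\<lambda>\<eta>. f' (0, \<eta>))) (at w)"
    by (rule has_derivative_compose [where g = f and f = "\<lambda>\<eta>. (z, \<eta>)", OF _ f'])
      (intro has_derivative_Pair has_derivative_ident has_derivative_const)
  from wirtinger_expansion [OF this] have 2: "f' (0, \<eta>) = C * \<eta> + E * cnj \<eta>" for \<eta>
    by (simp add: C_def E_def)
  have f'_eq: "f' (u, \<eta>) = A * u + B * cnj u + C * \<eta> + E * cnj \<eta>" for u \<eta>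
    using linear_add [OF has_derivative_linear [OF f'], of "(u, 0)" "(0, \<eta>)"] by (simp add: 1 2)
  \<comment> \<open>If \<open>E = 0\<close>, then \<open>F u\<close> is the differential of \<open>f\<close> on the horizontal lift \<open>(u, h u)\<close>.\<close>
  define F where "F u = (A + C * k) * u + (B + C * (P - w * k)) * cnj u" for u
  have *: "f' (twistor_J nabla (z, w) X) - \<i> * f' X = F (j (fst X)) - \<i> * F (fst X)" if "E = 0" for X
    using that by (cases X) (simp add: J f'_eq h F_def algebra_simps)
  have "E = 0" if ?L
  proof -
    \<comment> \<open>Evaluate at the vertical vector \<open>(0, 1)\<close>, which \<open>J\<close> maps to \<open>(0, \<i>)\<close>.\<close>
    have "f' (0, \<i>) = \<i> * f' (0, 1)"
      using that [folded f'_def, rule_format, of "(0, 1)"]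
      by (simp add: J linear_0 [OF linear_fibre_structure] linear_0 [OF linear_horizontal_lift]
          j_def h_def)
    then show ?thesis
      by (simp add: f'_eq algebra_simps)
  qed
  moreover have "?L \<longleftrightarrow> B + w * A + P * C = 0" if "E = 0"
  proof -
    have "?L \<longleftrightarrow> (\<forall>u. F (j u) = \<i> * F u)"
      unfolding f'_def [symmetric] using * [OF that] by (metis eq_iff_diff_eq_0 fst_conv)
    also have "\<dots> \<longleftrightarrow> (B + C * (P - w * k)) + w * (A + C * k) = 0"
      unfolding F_def j_def by (rule fibre_structure_holomorphic_iff [OF w])
    also have "(B + C * (P - w * k)) + w * (A + C * k) = B + w * A + P * C"
      by (simp add: algebra_simps)
    finally show ?thesis .
  qed
  ultimately show ?thesis
    unfolding A_def [symmetric] B_def [symmetric] C_def [symmetric] E_def [symmetric]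
      P_def [symmetric] by blast
qed

lemma holomorphic_section_iff:
  assumes "symplectic_connection nabla" and "connection_parameters nabla \<alpha> \<beta>"
    and sec: "twistor_section j" and j: "\<And>z. j z = (z, w z)"
  shows "holomorphic_section nabla j \<longleftrightarrow>
           (\<forall>z. wirtinger_bar w z + w z * wirtinger w z - twistor_P \<alpha> \<beta> z (w z) = 0)"
proof -
  have "(\<forall>v. frechet_derivative j (at z) (tautological (j z) v)
              = twistor_J nabla (j z) (frechet_derivative j (at z) v)) \<longleftrightarrow>
        wirtinger_bar w z + w z * wirtinger w z - twistor_P \<alpha> \<beta> z (w z) = 0" for z
  proof -
    define A B where "A = wirtinger w z" and "B = wirtinger_bar w z"
    define i where "i = fibre_structure (w z)"
    define h where "h = horizontal_lift \<alpha> \<beta> (z, w z)"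
    define k where "k = cnj (\<alpha> z) - 2 * \<alpha> z * w z + \<beta> z * (w z)\<^sup>2"
    define P where "P = twistor_P \<alpha> \<beta> z (w z)"
    have mem: "(z, w z) \<in> twistor_space"
      using sec unfolding twistor_section_def j by blast
    then have w1: "cmod (w z) < 1"
      by (simp add: twistor_space_def)
    have J: "twistor_J nabla (z, w z) X = (i (fst X), h (i (fst X)) + \<i> * (snd X - h (fst X)))" for X
      using twistor_J_eq [OF assms(1,2) mem] by (simp add: i_def h_def)
    have h: "h u = k * u + (P - w z * k) * cnj u" for u
      unfolding h_def k_def P_def by (rule horizontal_lift_eq_twistor_P)
    have "j differentiable (at z)"
      using sec smooth_on_imp_differentiable unfolding twistor_section_def by blast
    then obtain j' where j': "(j has_derivative j') (at z)"
      by (auto simp: differentiable_def)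
    have w': "(w has_derivative (\<lambda>v. snd (j' v))) (at z)"
      using has_derivative_snd [OF j'] by (simp add: j)
    have j_eq: "j = (\<lambda>z. (z, w z))"
      by (rule ext) (rule j)
    have "((\<lambda>z. (z, w z)) has_derivative (\<lambda>v. (v, snd (j' v)))) (at z)"
      by (intro has_derivative_Pair has_derivative_ident w')
    then have "(j has_derivative (\<lambda>v. (v, A * v + B * cnj v))) (at z)"
      unfolding wirtinger_expansion [OF w'] A_def B_def j_eq .
    then have fd: "frechet_derivative j (at z) = (\<lambda>v. (v, A * v + B * cnj v))"
      by (simp add: frechet_derivative_at [symmetric])
    \<comment> \<open>\<open>F u\<close> is the vertical part of the differential of \<open>j\<close> at \<open>u\<close>.\<close>
    define F where "F u = (A - k) * u + (B - (P - w z * k)) * cnj u" for u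
    have "(\<forall>v. frechet_derivative j (at z) (tautological (j z) v)
              = twistor_J nabla (j z) (frechet_derivative j (at z) v)) \<longleftrightarrow>
          (\<forall>v. F (i v) = \<i> * F v)"
      unfolding fd j J tautological_eq [OF mem] by (simp add: i_def [symmetric] F_def h algebra_simps)
    also have "\<dots> \<longleftrightarrow> (B - (P - w z * k)) + w z * (A - k) = 0"
      unfolding F_def i_def by (rule fibre_structure_holomorphic_iff [OF w1])
    also have "(B - (P - w z * k)) + w z * (A - k) = B + w z * A - P"
      by (simp add: algebra_simps)
    finally show ?thesis
      by (simp add: A_def B_def P_def)
  qed
  then show ?thesis
    by (simp add: holomorphic_section_def)
qed

theorem proposition3p3:
  fixes nabla :: "(complex \<Rightarrow> complex) \<Rightarrow> (complex \<Rightarrow> complex) \<Rightarrow> complex \<Rightarrow> complex"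
    and \<alpha> \<beta> :: "complex \<Rightarrow> complex"
  assumes "symplectic_connection nabla"
    and "connection_parameters nabla \<alpha> \<beta>"
  shows "(\<forall>U f. open U \<longrightarrow> U \<subseteq> twistor_space \<longrightarrow> smooth_on U f \<longrightarrow>
            (twistor_holomorphic_on nabla U f \<longleftrightarrow>
              (\<forall>(z, w) \<in> U.
                 wirtinger_bar (\<lambda>\<eta>. f (z, \<eta>)) w = 0 \<and>
                 wirtinger_bar (\<lambda>\<zeta>. f (\<zeta>, w)) z + w * wirtinger (\<lambda>\<zeta>. f (\<zeta>, w)) z
                   + twistor_P \<alpha> \<beta> z w * wirtinger (\<lambda>\<eta>. f (z, \<eta>)) w = 0)))
       \<and> (\<forall>j w. twistor_section j \<longrightarrow> (\<forall>z. j z = (z, w z)) \<longrightarrow>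
            (holomorphic_section nabla j \<longleftrightarrow>
              (\<forall>z. wirtinger_bar w z + w z * wirtinger w z - twistor_P \<alpha> \<beta> z (w z) = 0)))"
proof (intro conjI allI impI)
  fix U and f :: "complex \<times> complex \<Rightarrow> complex"
  assume U: "U \<subseteq> twistor_space" and f: "smooth_on U f"
  have "f differentiable (at p) \<and>
      (\<forall>X. frechet_derivative f (at p) (twistor_J nabla p X) = \<i> * frechet_derivative f (at p) X)
    \<longleftrightarrow> (case p of (z, w) \<Rightarrow>
         wirtinger_bar (\<lambda>\<eta>. f (z, \<eta>)) w = 0 \<and>
         wirtinger_bar (\<lambda>\<zeta>. f (\<zeta>, w)) z + w * wirtinger (\<lambda>\<zeta>. f (\<zeta>, w)) z
           + twistor_P \<alpha> \<beta> z w * wirtinger (\<lambda>\<eta>. f (z, \<eta>)) w = 0)" if "p \<in> U" for p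
  proof -
    obtain z w where p: "p = (z, w)" by (cases p)
    have "f differentiable (at (z, w))"
      using smooth_on_imp_differentiable [OF f that] unfolding p .
    moreover have "cmod w < 1"
      using U that by (auto simp: p twistor_space_def)
    ultimately show ?thesis
      using twistor_holomorphic_at_iff [OF assms] unfolding p prod.case by blast
  qed
  then show "twistor_holomorphic_on nabla U f \<longleftrightarrow>
      (\<forall>(z, w) \<in> U.
         wirtinger_bar (\<lambda>\<eta>. f (z, \<eta>)) w = 0 \<and>
         wirtinger_bar (\<lambda>\<zeta>. f (\<zeta>, w)) z + w * wirtinger (\<lambda>\<zeta>. f (\<zeta>, w)) z
           + twistor_P \<alpha> \<beta> z w * wirtinger (\<lambda>\<eta>. f (z, \<eta>)) w = 0)"
    unfolding twistor_holomorphic_on_def by (rule ball_cong [OF refl])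
next
  fix j w
  assume "twistor_section j" and "\<forall>z. j z = (z, w z)"
  then show "holomorphic_section nabla j \<longleftrightarrow>
      (\<forall>z. wirtinger_bar w z + w z * wirtinger w z - twistor_P \<alpha> \<beta> z (w z) = 0)"
    using holomorphic_section_iff [OF assms] by blast
qed

end
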